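(* There exists a transcendental skew-product $F:\mathbb{C}^2\to\mathbb{C}^2$ having a Baker domain.
   Context: A transcendental skew-product is a mapping $F:\mathbb{C}^2\to\mathbb{C}^2$ of the form $F(z,w)=(f(z,w),g(w))$, where $f:\mathbb{C}^2\to\mathbb{C}$ and $g:\mathbb{C}\to\mathbb{C}$ are transcendental entire functions (entire and not polynomial). View $\mathbb{C}^2$ as a subset of $\mathbb{P}^2(\mathbb{C})$ via $(z,w)\mapsto[z:w:1]$; the points at infinity are the points $[p:q:0]$. The Fatou set of $F$ is the largest open subset of $\mathbb{C}^2$ on which the family of iterates $\{F^n\}_{n\in\mathbb{N}}$ is normal, where normal means that every sequence of iterates has a subsequence converging uniformly on compact subsets as maps into $\mathbb{P}^2(\mathbb{C})$. A Fatou component is a connected component of the Fatou set. A point $[p:q:0]$ is an essential singularity at infinity of $F$ if for every point $[s:t:0]$ there exists a sequence $(z_n,w_n)\in\mathbb{C}^2$ converging to $[p:q:0]$ in $\mathbb{P}^2(\mathbb{C})$ such that $F(z_n,w_n)$ converges to $[s:t:0]$. A Baker domain of $F$ is a Fatou component $U$ of $F$ for which the orbit of every point of $U$ converges to a point at infinity that is an essential singularity at infinity of $F$. *)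

theory Defs
  imports "HOL-Complex_Analysis.Complex_Analysis"
begin

section \<open>The complex projective plane\<close>

quotient_type proj2 = "complex ^ 3" / partial:
  "\<lambda>x y. x \<noteq> 0 \<and> y \<noteq> 0 \<and> (\<exists>c. y = c *s x)"
proof (rule part_equivpI)
  show "\<exists>x :: complex ^ 3. x \<noteq> 0 \<and> x \<noteq> 0 \<and> (\<exists>c. x = c *s x)"
    by (rule exI[of _ "axis 1 1"]) (auto simp: axis_eq_0_iff intro!: exI[of _ 1])
  show "symp (\<lambda>x y :: complex ^ 3. x \<noteq> 0 \<and> y \<noteq> 0 \<and> (\<exists>c. y = c *s x))"
  proof (rule sympI, elim conjE exE, intro conjI)
    fix x y :: "complex ^ 3" and c assume *: "x \<noteq> 0" "y \<noteq> 0" "y = c *s x"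
    then have "c \<noteq> 0" by auto
    then have "x = inverse c *s y" using * by (simp add: vector_smult_assoc)
    then show "\<exists>c. x = c *s y" ..
  qed auto
  show "transp (\<lambda>x y :: complex ^ 3. x \<noteq> 0 \<and> y \<noteq> 0 \<and> (\<exists>c. y = c *s x))"
    by (rule transpI) (auto simp: vector_smult_assoc)
qed

text \<open>The metric is the distance between orthogonal projections: the line spanned by \<open>x\<close> is
  represented by the matrix \<open>x x\<^sup>* / \<parallel>x\<parallel>\<^sup>2\<close>, and \<open>norm\<close> on matrices is the Hilbert--Schmidt norm.
  If \<open>\<theta>\<close> is the angle between two lines, their distance is \<open>sqrt 2 * sin \<theta>\<close>. That this metric
  induces the quotient topology is \<open>open_proj2_iff\<close> below.\<close>

definition line_proj :: "complex ^ 3 \<Rightarrow> complex ^ 3 ^ 3" where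
  "line_proj x = (\<chi> i j. x $ i * cnj (x $ j) / of_real ((norm x)\<^sup>2))"

lemma norm_vector_smult: "norm (c *s x) = norm c * norm (x :: complex ^ 3)"
  by (simp add: norm_vec_def L2_set_def norm_mult power_mult_distrib sum_distrib_left[symmetric]
      real_sqrt_mult)

lemma line_proj_smult:
  assumes "c \<noteq> 0"
  shows "line_proj (c *s x) = line_proj x"
proof -
  have "c * cnj c = of_real ((norm c)\<^sup>2)"
    by (metis complex_norm_square)
  then have "c * a * cnj (c * b) / of_real ((norm (c *s x))\<^sup>2) = a * cnj b / of_real ((norm x)\<^sup>2)"
    for a b
    using assms by (simp add: norm_vector_smult power_mult_distrib mult_ac)
  then show ?thesis by (simp add: line_proj_def vec_eq_iff)
qed

lift_definition proj_matrix :: "proj2 \<Rightarrow> complex ^ 3 ^ 3" is line_proj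
  by (auto intro!: line_proj_smult[symmetric])

lemma proj_matrix_inject: "proj_matrix p = proj_matrix q \<longleftrightarrow> p = q"
proof
  assume "proj_matrix p = proj_matrix q"
  then show "p = q"
  proof transfer
    fix x y :: "complex ^ 3"
    assume x: "x \<noteq> 0 \<and> x \<noteq> 0 \<and> (\<exists>c. x = c *s x)" and y: "y \<noteq> 0 \<and> y \<noteq> 0 \<and> (\<exists>c. y = c *s y)"
      and eq: "line_proj x = line_proj y"
    define a b :: complex where "a = of_real ((norm x)\<^sup>2)" and "b = of_real ((norm y)\<^sup>2)"
    have ab: "a \<noteq> 0" "b \<noteq> 0" using x y by (auto simp: a_def b_def)
    have e: "x $ i * cnj (x $ j) / a = y $ i * cnj (y $ j) / b" for i j
      using arg_cong[OF eq, of "\<lambda>m. m $ i $ j"] by (simp add: line_proj_def a_def b_def)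
    obtain j where j: "y $ j \<noteq> 0" using y by (auto simp: vec_eq_iff)
    have "y = (b * cnj (x $ j) / (a * cnj (y $ j))) *s x"
      using e[of _ j] ab j by (simp add: vec_eq_iff field_simps)
    then show "x \<noteq> 0 \<and> y \<noteq> 0 \<and> (\<exists>c. y = c *s x)" using x y by blast
  qed
qed simp

instantiation proj2 :: metric_space
begin

definition dist_proj2 :: "proj2 \<Rightarrow> proj2 \<Rightarrow> real" where
  "dist_proj2 p q = norm (proj_matrix p - proj_matrix q)"

definition uniformity_proj2 :: "(proj2 \<times> proj2) filter" where
  "uniformity_proj2 = (INF e\<in>{0<..}. principal {(p, q). dist p q < e})"

definition open_proj2 :: "proj2 set \<Rightarrow> bool" where
  "open_proj2 U = (\<forall>p\<in>U. \<forall>\<^sub>F (p', q) in uniformity. p' = p \<longrightarrow> q \<in> U)"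

instance
proof
  fix p q r :: proj2
  show "dist p q = 0 \<longleftrightarrow> p = q"
    by (simp add: dist_proj2_def proj_matrix_inject)
  show "dist p q \<le> dist p r + dist q r"
    unfolding dist_proj2_def by (metis dist_norm dist_triangle2)
qed (simp_all add: uniformity_proj2_def open_proj2_def)

end

lemma abs_proj2_eq_iff:
  assumes "x \<noteq> 0" "y \<noteq> 0"
  shows "abs_proj2 x = abs_proj2 y \<longleftrightarrow> (\<exists>c. y = c *s x)"
  using Quotient3_rel[OF Quotient3_proj2, of x y] assms
  by (auto intro: exI[of _ 1])

lemma proj_matrix_abs: "x \<noteq> 0 \<Longrightarrow> proj_matrix (abs_proj2 x) = line_proj x"
  by (rule proj_matrix.abs_eq) (auto intro!: exI[of _ 1])

lemma continuous_on_abs_proj2: "continuous_on (- {0}) abs_proj2"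
proof -
  have "continuous_on (- {0}) line_proj"
    unfolding line_proj_def by (intro continuous_intros) auto
  then show ?thesis
    by (auto simp: continuous_on_iff dist_proj2_def proj_matrix_abs dist_norm)
qed

lemma ex_unit_rep: "\<exists>x. norm x = 1 \<and> abs_proj2 x = p"
proof (induct p)
  case (1 x)
  then have x: "x \<noteq> 0" by auto
  define y where "y = of_real (inverse (norm x)) *s x"
  have y: "norm y = 1" using x by (simp add: y_def norm_vector_smult norm_inverse)
  then have "abs_proj2 x = abs_proj2 y" using x by (subst abs_proj2_eq_iff) (auto simp: y_def)
  then show ?case using y by auto
qed

lemma open_proj2_iff: "open U \<longleftrightarrow> open {x. x \<noteq> 0 \<and> abs_proj2 x \<in> U}"
proof
  assume "open U"
  then have "open (abs_proj2 -` U \<inter> - {0})"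
    using continuous_on_abs_proj2 by (subst (asm) continuous_on_open_vimage) auto
  then show "open {x. x \<noteq> 0 \<and> abs_proj2 x \<in> U}"
    by (rule back_subst[where P = "open"]) auto
next
  let ?V = "{x. x \<noteq> 0 \<and> abs_proj2 x \<in> U}"
  assume "open ?V"
  then have "compact (sphere 0 1 - ?V)" by (intro compact_diff compact_sphere)
  then have "compact (abs_proj2 ` (sphere 0 1 - ?V))"
    by (intro compact_continuous_image continuous_on_subset[OF continuous_on_abs_proj2]) auto
  moreover have "abs_proj2 ` (sphere 0 1 - ?V) = - U"
  proof (intro equalityI subsetI)
    fix p assume "p \<in> - U"
    then show "p \<in> abs_proj2 ` (sphere 0 1 - ?V)" using ex_unit_rep[of p] by force
  qed auto
  ultimately show "open U" using compact_imp_closed by (auto simp: open_closed)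
qed

definition hom_pt :: "complex \<Rightarrow> complex \<Rightarrow> complex \<Rightarrow> proj2" where
  "hom_pt p q r = abs_proj2 (vector [p, q, r])"

definition line_at_infinity :: "proj2 set" where
  "line_at_infinity = {hom_pt p q 0 | p q. (p, q) \<noteq> (0, 0)}"

definition affine_embed :: "complex \<times> complex \<Rightarrow> proj2" where
  "affine_embed = (\<lambda>(z, w). hom_pt z w 1)"


section \<open>Transcendental skew-products\<close>

text \<open>Complex differentiability: the real derivative at each point is complex linear.\<close>

definition entire2 :: "(complex \<times> complex \<Rightarrow> complex) \<Rightarrow> bool" where
  "entire2 f \<longleftrightarrow> (\<forall>x. \<exists>a b. (f has_derivative (\<lambda>(h, k). a * h + b * k)) (at x))"

definition polynomial2 :: "(complex \<times> complex \<Rightarrow> complex) \<Rightarrow> bool" where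
  "polynomial2 f \<longleftrightarrow>
    (\<exists>(N :: nat) c. \<forall>z w. f (z, w) = (\<Sum>i\<le>N. \<Sum>j\<le>N. c i j * z ^ i * w ^ j))"

definition transcendental_entire2 :: "(complex \<times> complex \<Rightarrow> complex) \<Rightarrow> bool" where
  "transcendental_entire2 f \<longleftrightarrow> entire2 f \<and> \<not> polynomial2 f"

definition transcendental_entire :: "(complex \<Rightarrow> complex) \<Rightarrow> bool" where
  "transcendental_entire g \<longleftrightarrow> g holomorphic_on UNIV \<and> \<not> (\<exists>p. g = poly p)"

definition transcendental_skew_product ::
  "(complex \<times> complex \<Rightarrow> complex \<times> complex) \<Rightarrow> bool" where
  "transcendental_skew_product F \<longleftrightarrow>
    (\<exists>f g. transcendental_entire2 f \<and> transcendental_entire g \<and> F = (\<lambda>(z, w). (f (z, w), g w)))"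


section \<open>Fatou components and Baker domains\<close>

text \<open>An arbitrary sequence of iterates is \<open>\<lambda>k. F ^^ m k\<close> for some \<open>m :: nat \<Rightarrow> nat\<close>.\<close>

definition iterates_normal_on ::
  "(complex \<times> complex \<Rightarrow> complex \<times> complex) \<Rightarrow> (complex \<times> complex) set \<Rightarrow> bool" where
  "iterates_normal_on F U \<longleftrightarrow>
    (\<forall>m :: nat \<Rightarrow> nat. \<exists>r h. strict_mono r \<and>
      (\<forall>K. compact K \<longrightarrow> K \<subseteq> U \<longrightarrow>
        uniform_limit K (\<lambda>k x. affine_embed ((F ^^ m (r k)) x)) h sequentially))"

text \<open>Normality is local (by a diagonal argument), so this union is the largest open set of
  normality.\<close>

definition fatou_set ::
  "(complex \<times> complex \<Rightarrow> complex \<times> complex) \<Rightarrow> (complex \<times> complex) set" where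
  "fatou_set F = \<Union> {U. open U \<and> iterates_normal_on F U}"

definition fatou_component ::
  "(complex \<times> complex \<Rightarrow> complex \<times> complex) \<Rightarrow> (complex \<times> complex) set \<Rightarrow> bool" where
  "fatou_component F U \<longleftrightarrow> U \<in> components (fatou_set F)"

definition essential_singularity_at_infinity ::
  "(complex \<times> complex \<Rightarrow> complex \<times> complex) \<Rightarrow> proj2 \<Rightarrow> bool" where
  "essential_singularity_at_infinity F P \<longleftrightarrow> P \<in> line_at_infinity \<and>
    (\<forall>Q \<in> line_at_infinity. \<exists>x :: nat \<Rightarrow> complex \<times> complex.
      (\<lambda>n. affine_embed (x n)) \<longlonglongrightarrow> P \<and> (\<lambda>n. affine_embed (F (x n))) \<longlonglongrightarrow> Q)"

definition baker_domain ::
  "(complex \<times> complex \<Rightarrow> complex \<times> complex) \<Rightarrow> (complex \<times> complex) set \<Rightarrow> bool" where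
  "baker_domain F U \<longleftrightarrow> fatou_component F U \<and>
    (\<forall>x \<in> U. \<exists>P. essential_singularity_at_infinity F P \<and>
      (\<lambda>n. affine_embed ((F ^^ n) x)) \<longlonglongrightarrow> P)"

end

theory Submission
  imports Defs "HOL-Real_Asymp.Real_Asymp"
begin

text \<open>The example is \<open>F(z, w) = (z + 2 + exp (- z), exp (w - 1))\<close>, a product of two functions of one
  variable. The first belongs to the family of Fatou's function \<open>z + 1 + exp (- z)\<close>: on the right
  half-plane \<open>exp (- z)\<close> has modulus below 1, so each step moves \<open>Re z\<close> to the right by more than 1.
  The second maps the unit disc into itself, because \<open>\<bar>exp (w - 1)\<bar> = exp (Re w - 1)\<close>. Hence the domain
  \<open>V = {Re z > 0} \<times> {\<bar>w\<bar> < 1}\<close> is invariant, and on \<open>V\<close> the iterates converge uniformly to the point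
  \<open>P = [1:0:0]\<close>. So \<open>V\<close> lies in one Fatou component \<open>U\<close>.

  That all orbits of \<open>U\<close>, and not only those of \<open>V\<close>, converge to \<open>P\<close> is true for every entire map
  (\<open>fatou_component_horizontal_limit\<close>). Let \<open>A\<close> be the interior of the set of points whose orbits
  converge to \<open>P\<close>. Normality gives equicontinuity, so every point of \<open>U\<close> in the closure of \<open>A\<close> has a
  ball that is mapped close to \<open>P\<close> by all late iterates. There the affine coordinates \<open>1/z\<close> and \<open>w/z\<close>
  around \<open>P\<close> are bounded holomorphic functions of the starting point, and they tend to 0 on a
  nonempty open set; by Vitali's theorem they tend to 0 on the whole ball. So \<open>A\<close> is relatively closed in
  the connected set \<open>U\<close>.

  The point \<open>P\<close> is an essential singularity because the two coordinates can be tuned separately.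
  Let \<open>w = n + 1\<close>, so that the second coordinate of the image is \<open>exp n\<close>, and let \<open>exp (- z)\<close> be about
  \<open>c exp n\<close>. This determines \<open>z\<close> only up to multiples of \<open>2\<pi>\<i>\<close>, and adding \<open>2\<pi>\<i> n\<^sup>2\<close> makes \<open>z\<close> much larger
  than \<open>w\<close> and yet negligible against \<open>exp n\<close>. Then the points tend to \<open>P\<close> and their images to
  \<open>[c:1:0]\<close>. The remaining point \<open>P\<close> itself is reached along any orbit in \<open>V\<close>.\<close>

section \<open>Convergence in the projective plane\<close>

lemma vector3_nonzero_iff: "vector [p, q, r] \<noteq> (0 :: complex ^ 3) \<longleftrightarrow> (p, q, r) \<noteq> (0, 0, 0)"
  by (auto simp: vec_eq_iff forall_3)

lemma hom_pt_scale:
  assumes "c \<noteq> 0" "(p, q, r) \<noteq> (0, 0, 0)"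
  shows "hom_pt (c * p) (c * q) (c * r) = hom_pt p q r"
  unfolding hom_pt_def
proof (subst abs_proj2_eq_iff)
  show "\<exists>d. vector [p, q, r] = d *s (vector [c * p, c * q, c * r] :: complex ^ 3)"
    by (rule exI[of _ "inverse c"]) (use assms in \<open>auto simp: vec_eq_iff forall_3\<close>)
qed (use assms in \<open>auto simp: vector3_nonzero_iff\<close>)

lemma tendsto_hom_pt:
  assumes "(p \<longlongrightarrow> a) G" "(q \<longlongrightarrow> b) G" "(r \<longlongrightarrow> c) G" "(a, b, c) \<noteq> (0, 0, 0)"
  shows "((\<lambda>n. hom_pt (p n) (q n) (r n)) \<longlongrightarrow> hom_pt a b c) G"
  unfolding hom_pt_def
proof (rule isCont_tendsto_compose[where g = abs_proj2])
  have "vector [a, b, c] \<in> - {0 :: complex ^ 3}"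
    using assms(4) by (auto simp: vector3_nonzero_iff)
  then show "isCont abs_proj2 (vector [a, b, c])"
    using continuous_on_abs_proj2 by (simp add: continuous_on_eq_continuous_at open_Compl)
  show "((\<lambda>n. vector [p n, q n, r n] :: complex ^ 3) \<longlongrightarrow> vector [a, b, c]) G"
  proof (rule vec_tendstoI)
    fix i :: 3
    show "((\<lambda>n. (vector [p n, q n, r n] :: complex ^ 3) $ i) \<longlongrightarrow> (vector [a, b, c] :: complex ^ 3) $ i) G"
      using exhaust_3[of i] assms(1-3) by auto
  qed
qed

text \<open>Homogeneous coordinates may be rescaled by an arbitrary factor \<open>c\<close>; if the rescaled first two
  coordinates converge while the third one, which is \<open>c\<close>, vanishes, the limit is at infinity.\<close>

lemma affine_embed_tendsto_infinity:
  assumes "((\<lambda>n. c n * z n) \<longlongrightarrow> p) G" "((\<lambda>n. c n * w n) \<longlongrightarrow> q) G" "(c \<longlongrightarrow> 0) G"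
    and "\<forall>\<^sub>F n in G. c n \<noteq> 0" "(p, q) \<noteq> (0, 0)"
  shows "((\<lambda>n. affine_embed (z n, w n)) \<longlongrightarrow> hom_pt p q 0) G"
proof -
  have "\<forall>\<^sub>F n in G. hom_pt (c n * z n) (c n * w n) (c n) = affine_embed (z n, w n)"
    using assms(4)
  proof eventually_elim
    case (elim n)
    then show ?case using hom_pt_scale[of "c n" "z n" "w n" 1] by (simp add: affine_embed_def)
  qed
  moreover have "((\<lambda>n. hom_pt (c n * z n) (c n * w n) (c n)) \<longlongrightarrow> hom_pt p q 0) G"
    using assms by (intro tendsto_hom_pt) auto
  ultimately show ?thesis by (rule Lim_transform_eventually[rotated])
qed

text \<open>The point \<open>[1:0:0]\<close> has the affine coordinates \<open>w/z\<close> and \<open>1/z\<close>. The polydisc of radius \<open>k\<close> in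
  these coordinates is a neighbourhood because its preimage in \<open>\<complex>\<^sup>3\<close> is an open cone.\<close>

lemma eventually_nhds_horizontal:
  assumes "k > 0"
  shows "\<forall>\<^sub>F P in nhds (hom_pt 1 0 0).
           \<forall>z w. P = affine_embed (z, w) \<longrightarrow> norm w < k * norm z \<and> 1 < k * norm z"
proof -
  define C where "C = {x :: complex ^ 3. norm (x $ 2) < k * norm (x $ 1) \<and> norm (x $ 3) < k * norm (x $ 1)}"
  have ne: "x \<noteq> 0" if "x \<in> C" for x using that by (auto simp: C_def)
  have "{x. x \<noteq> 0 \<and> abs_proj2 x \<in> abs_proj2 ` C} = C"
  proof (intro equalityI subsetI)
    fix y assume y: "y \<in> {x. x \<noteq> 0 \<and> abs_proj2 x \<in> abs_proj2 ` C}"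
    then obtain x where x: "x \<in> C" "abs_proj2 x = abs_proj2 y" by auto
    then obtain c where c: "y = c *s x"
      using y ne abs_proj2_eq_iff[of x y] by blast
    then have "norm c > 0" using y by auto
    then show "y \<in> C" using x(1) by (simp add: C_def c norm_mult mult.left_commute)
  qed (use ne in auto)
  moreover have "open C"
    unfolding C_def by (intro open_Collect_conj open_Collect_less continuous_intros)
  ultimately have "open (abs_proj2 ` C)" by (simp add: open_proj2_iff)
  moreover have "hom_pt 1 0 0 \<in> abs_proj2 ` C"
    using assms by (auto simp: hom_pt_def C_def)
  ultimately have "\<forall>\<^sub>F P in nhds (hom_pt 1 0 0). P \<in> abs_proj2 ` C"
    by (rule eventually_nhds_in_open)
  then show ?thesis
  proof eventually_elim
    case (elim P)
    show ?case
    proof (intro allI impI)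
      fix z w assume "P = affine_embed (z, w)"
      then obtain x where x: "x \<in> C" "abs_proj2 x = abs_proj2 (vector [z, w, 1])"
        using elim by (auto simp: affine_embed_def hom_pt_def)
      then obtain c where c: "vector [z, w, 1] = c *s x"
        using ne abs_proj2_eq_iff[of x "vector [z, w, 1]"] by (auto simp: vector3_nonzero_iff)
      have e: "z = c * x $ 1" "w = c * x $ 2" "c * x $ 3 = 1"
        using arg_cong[OF c, of "\<lambda>v :: complex ^ 3. v $ 1"] arg_cong[OF c, of "\<lambda>v :: complex ^ 3. v $ 2"]
          arg_cong[OF c, of "\<lambda>v :: complex ^ 3. v $ 3"] by simp_all
      then have "norm c > 0" by auto
      then have "norm (c * x $ 2) < k * norm (c * x $ 1)" "norm (c * x $ 3) < k * norm (c * x $ 1)"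
        using x(1) by (simp_all add: C_def norm_mult mult.left_commute)
      then show "norm w < k * norm z \<and> 1 < k * norm z" by (simp add: e)
    qed
  qed
qed

lemma affine_embed_tendsto_horizontalD:
  assumes "((\<lambda>n. affine_embed (z n, w n)) \<longlongrightarrow> hom_pt 1 0 0) G"
  shows "((\<lambda>n. 1 / z n) \<longlongrightarrow> 0) G" "((\<lambda>n. w n / z n) \<longlongrightarrow> 0) G"
proof -
  have ev: "\<forall>\<^sub>F n in G. norm (w n / z n) < k \<and> norm (1 / z n) < k" if "k > 0" for k :: real
    using filterlim_iff[THEN iffD1, OF assms, rule_format, OF eventually_nhds_horizontal[OF that]]
  proof eventually_elim
    case (elim n)
    then have *: "norm (w n) < k * norm (z n)" "1 < k * norm (z n)" by auto
    then have "norm (z n) > 0" by (cases "z n = 0") auto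
    then show ?case using * by (simp add: norm_divide pos_divide_less_eq)
  qed
  show "((\<lambda>n. 1 / z n) \<longlongrightarrow> 0) G" "((\<lambda>n. w n / z n) \<longlongrightarrow> 0) G"
    by (auto simp: tendsto_iff elim!: eventually_mono[OF ev])
qed

lemma affine_embed_tendsto_horizontalI:
  assumes "((\<lambda>n. 1 / z n) \<longlongrightarrow> 0) G" "((\<lambda>n. w n / z n) \<longlongrightarrow> 0) G" "\<forall>\<^sub>F n in G. z n \<noteq> 0"
  shows "((\<lambda>n. affine_embed (z n, w n)) \<longlongrightarrow> hom_pt 1 0 0) G"
proof (rule affine_embed_tendsto_infinity)
  show "((\<lambda>n. 1 / z n * z n) \<longlongrightarrow> 1) G"
    by (rule tendsto_eventually) (use assms(3) in \<open>auto elim: eventually_mono\<close>)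
qed (use assms in \<open>auto elim: eventually_mono\<close>)

lemma continuous_on_affine_embed: "continuous_on S affine_embed"
  unfolding continuous_on_def affine_embed_def case_prod_beta
  by (intro ballI tendsto_hom_pt tendsto_intros) auto


section \<open>Entire maps\<close>

lemma entire2D:
  assumes "entire2 f"
  obtains a b where "(f has_derivative (\<lambda>d. a * fst d + b * snd d)) (at x)"
  using assms that unfolding entire2_def case_prod_beta by blast

lemma entire2I:
  assumes "\<And>x. \<exists>a b. (f has_derivative (\<lambda>d. a * fst d + b * snd d)) (at x)"
  shows "entire2 f"
  using assms unfolding entire2_def case_prod_beta by blast

lemma entire2_compose:
  assumes "entire2 f" "entire2 u" "entire2 v"
  shows "entire2 (\<lambda>x. f (u x, v x))"
proof (rule entire2I)
  fix x
  obtain p q where f: "(f has_derivative (\<lambda>d. p * fst d + q * snd d)) (at (u x, v x))"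
    using entire2D[OF assms(1)] .
  obtain a b where u: "(u has_derivative (\<lambda>d. a * fst d + b * snd d)) (at x)"
    using entire2D[OF assms(2)] .
  obtain c e where v: "(v has_derivative (\<lambda>d. c * fst d + e * snd d)) (at x)"
    using entire2D[OF assms(3)] .
  have "((\<lambda>x. f (u x, v x)) has_derivative
      (\<lambda>d. (p * a + q * c) * fst d + (p * b + q * e) * snd d)) (at x)"
    using has_derivative_compose[OF has_derivative_Pair[OF u v] f]
    by (simp add: algebra_simps)
  then show "\<exists>a b. ((\<lambda>x. f (u x, v x)) has_derivative (\<lambda>d. a * fst d + b * snd d)) (at x)"
    by blast
qed

lemma entire2_fst: "entire2 fst" and entire2_snd: "entire2 snd"
proof -
  show "entire2 fst"
    by (rule entire2I, rule exI[of _ 1], rule exI[of _ 0]) (auto intro!: derivative_eq_intros)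
  show "entire2 snd"
    by (rule entire2I, rule exI[of _ 0], rule exI[of _ 1]) (auto intro!: derivative_eq_intros)
qed

text \<open>With \<open>entire2_compose\<close>, this builds entire functions of two variables from those of one.\<close>

lemma entire2_holomorphic_comp:
  assumes "g holomorphic_on UNIV" "entire2 u"
  shows "entire2 (\<lambda>x. g (u x))"
proof (rule entire2I)
  fix x
  obtain a b where u: "(u has_derivative (\<lambda>d. a * fst d + b * snd d)) (at x)"
    using entire2D[OF assms(2)] .
  have "(g has_field_derivative deriv g (u x)) (at (u x))"
    by (rule holomorphic_derivI[OF assms(1)]) simp_all
  then have g: "(g has_derivative (\<lambda>h. deriv g (u x) * h)) (at (u x))"
    by (simp add: has_field_derivative_def)
  have "((\<lambda>x. g (u x)) has_derivative
      (\<lambda>d. (deriv g (u x) * a) * fst d + (deriv g (u x) * b) * snd d)) (at x)"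
    by (rule has_derivative_eq_rhs[OF has_derivative_compose[OF u g]])
       (simp add: fun_eq_iff algebra_simps)
  then show "\<exists>a b. ((\<lambda>x. g (u x)) has_derivative (\<lambda>d. a * fst d + b * snd d)) (at x)"
    by blast
qed

lemma entire2_holomorphic_on_line:
  assumes "entire2 f"
  shows "(\<lambda>t. f (a + t * c, b + t * d)) holomorphic_on S"
proof -
  have "\<exists>D. ((\<lambda>t. f (a + t * c, b + t * d)) has_field_derivative D) (at t)" for t
  proof -
    obtain p q where f: "(f has_derivative (\<lambda>d. p * fst d + q * snd d)) (at (a + t * c, b + t * d))"
      using entire2D[OF assms] .
    have "((\<lambda>t. (a + t * c, b + t * d)) has_derivative (\<lambda>h. (h * c, h * d))) (at t)"
      by (auto intro!: derivative_eq_intros)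
    from has_derivative_compose[OF this f]
    have "((\<lambda>t. f (a + t * c, b + t * d)) has_field_derivative p * c + q * d) (at t)"
      unfolding has_field_derivative_def
      by (rule has_derivative_eq_rhs) (simp add: fun_eq_iff algebra_simps)
    then show ?thesis ..
  qed
  then show ?thesis
    unfolding holomorphic_on_def field_differentiable_def
    by (blast intro: has_field_derivative_at_within)
qed

definition entire_map :: "(complex \<times> complex \<Rightarrow> complex \<times> complex) \<Rightarrow> bool" where
  "entire_map F \<longleftrightarrow> entire2 (\<lambda>x. fst (F x)) \<and> entire2 (\<lambda>x. snd (F x))"

lemma entire_map_funpow: "entire_map F \<Longrightarrow> entire_map (F ^^ n)"
proof (induction n)
  case 0
  then show ?case by (simp add: entire_map_def entire2_fst entire2_snd)
next
  case (Suc n)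
  then have "entire2 (\<lambda>x. fst ((F ^^ n) x))" "entire2 (\<lambda>x. snd ((F ^^ n) x))"
    by (auto simp: entire_map_def)
  then show ?case
    using Suc.prems entire2_compose[of "\<lambda>x. fst (F x)" "\<lambda>x. fst ((F ^^ n) x)" "\<lambda>x. snd ((F ^^ n) x)"]
      entire2_compose[of "\<lambda>x. snd (F x)" "\<lambda>x. fst ((F ^^ n) x)" "\<lambda>x. snd ((F ^^ n) x)"]
    by (simp add: entire_map_def)
qed

lemma entire2_continuous_on: "entire2 f \<Longrightarrow> continuous_on S f"
  by (intro continuous_at_imp_continuous_on ballI) (erule entire2D, erule has_derivative_continuous)

lemma entire_map_continuous_on:
  assumes "entire_map F"
  shows "continuous_on S F"
proof -
  have "continuous_on S (\<lambda>x. (fst (F x), snd (F x)))"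
    using assms by (intro continuous_on_Pair) (simp_all add: entire_map_def entire2_continuous_on)
  then show ?thesis by simp
qed

section \<open>Spreading of convergence to infinity\<close>

text \<open>The case of Vitali's theorem with limit 0: by Montel's theorem a sequence that does not tend to 0
  at some point would have a subsequence that stays away from 0 there and has a holomorphic limit;
  but the limit vanishes on \<open>T\<close>, hence on \<open>S\<close>.\<close>

lemma Vitali_zero:
  fixes \<phi> :: "nat \<Rightarrow> complex \<Rightarrow> complex"
  assumes S: "open S" "connected S" and hol: "\<And>n. \<phi> n holomorphic_on S"
    and bdd: "\<And>n x. x \<in> S \<Longrightarrow> norm (\<phi> n x) \<le> B"
    and T: "open T" "T \<noteq> {}" "T \<subseteq> S" and lim: "\<And>x. x \<in> T \<Longrightarrow> (\<lambda>n. \<phi> n x) \<longlonglongrightarrow> 0"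
    and x: "x \<in> S"
  shows "(\<lambda>n. \<phi> n x) \<longlonglongrightarrow> 0"
proof (rule ccontr)
  assume "\<not> ?thesis"
  then obtain e where e: "e > 0" "\<exists>\<^sub>F n in sequentially. norm (\<phi> n x) \<ge> e"
    by (auto simp: tendsto_iff frequently_def not_le)
  then have "infinite {n. norm (\<phi> n x) \<ge> e}"
    by (simp add: frequently_cofinite cofinite_eq_sequentially[symmetric])
  then obtain m :: "nat \<Rightarrow> nat" where m: "strict_mono m" "\<And>n. norm (\<phi> (m n) x) \<ge> e"
    using infinite_enumerate by blast
  obtain g r where g: "g holomorphic_on S" "strict_mono (r :: nat \<Rightarrow> nat)"
    and gl: "\<And>y. y \<in> S \<Longrightarrow> (\<lambda>n. \<phi> (m (r n)) y) \<longlonglongrightarrow> g y"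
    by (rule Montel[OF S(1), of "range \<phi>" "\<lambda>n. \<phi> (m n)"]) (use hol bdd in blast)+
  have mr: "strict_mono (\<lambda>n. m (r n))"
    using m(1) g(2) by (simp add: strict_mono_def)
  have "g y = 0" if "y \<in> T" for y
  proof (rule LIMSEQ_unique)
    show "(\<lambda>n. \<phi> (m (r n)) y) \<longlonglongrightarrow> g y" using gl that T by blast
    show "(\<lambda>n. \<phi> (m (r n)) y) \<longlonglongrightarrow> 0"
      using LIMSEQ_subseq_LIMSEQ[OF lim[OF that] mr] by (simp add: o_def)
  qed
  then have "g x = 0"
    using analytic_continuation_open[of T S g "\<lambda>_. 0"] S T g(1) x by auto
  then have "(\<lambda>n. norm (\<phi> (m (r n)) x)) \<longlonglongrightarrow> 0"
    using tendsto_norm[OF gl[OF x]] by simp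
  then have "e \<le> 0"
    by (rule LIMSEQ_le_const) (use m(2) in auto)
  then show False using e(1) by simp
qed

text \<open>Otherwise there are points \<open>y k\<close> tending to \<open>x\<close> and iterates that separate \<open>y k\<close> from \<open>x\<close> by at
  least \<open>e\<close>. A uniformly convergent subsequence of these iterates has a continuous limit, which rules
  this out.\<close>

lemma normal_imp_equicontinuous:
  assumes F: "entire_map F" and nor: "iterates_normal_on F U" and U: "open U" "x \<in> U" and e: "e > 0"
  obtains d where "d > 0" "ball x d \<subseteq> U"
    "\<And>n y. y \<in> ball x d \<Longrightarrow> dist (affine_embed ((F ^^ n) y)) (affine_embed ((F ^^ n) x)) < e"
proof -
  let ?f = "\<lambda>n y. affine_embed ((F ^^ n) y)"
  obtain R where R: "R > 0" "cball x R \<subseteq> U" using U open_contains_cball by blast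
  have "\<exists>d>0. \<forall>n. \<forall>y\<in>ball x d. dist (?f n y) (?f n x) < e"
  proof (rule ccontr)
    assume "\<not> ?thesis"
    then have "\<exists>n y. y \<in> ball x (min R (1 / Suc k)) \<and> dist (?f n y) (?f n x) \<ge> e" for k
    proof -
      have "min R (1 / Suc k) > 0" using R(1) by simp
      with \<open>\<not> _\<close> show ?thesis by (meson not_less)
    qed
    then obtain m y where y: "\<And>k. y k \<in> ball x (min R (1 / Suc k))"
      and far: "\<And>k. dist (?f (m k) (y k)) (?f (m k) x) \<ge> e" by metis
    obtain r h where r: "strict_mono (r :: nat \<Rightarrow> nat)"
      and "uniform_limit (cball x R) (\<lambda>k z. ?f (m (r k)) z) h sequentially"
      using nor R(2) unfolding iterates_normal_on_def by (metis compact_cball)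
    note unif = this(2)
    have cont: "continuous_on (cball x R) h"
    proof (rule uniform_limit_theorem[OF _ unif])
      show "\<forall>\<^sub>F k in sequentially. continuous_on (cball x R) (?f (m (r k)))"
        by (intro always_eventually allI
            continuous_on_compose2[OF continuous_on_affine_embed[of UNIV]]
            entire_map_continuous_on entire_map_funpow F) auto
    qed simp
    have yR: "y k \<in> cball x R" for k using y[of k] by auto
    have "y \<longlonglongrightarrow> x"
    proof (rule metric_LIMSEQ_I)
      fix c :: real assume "c > 0"
      then obtain N where N: "1 / Suc N < c" by (metis nat_approx_posE)
      have "dist (y k) x < c" if "k \<ge> N" for k
      proof -
        have "dist (y k) x < 1 / Suc k" using y[of k] by (simp add: dist_commute)
        also have "\<dots> \<le> 1 / Suc N" using that by (simp add: frac_le)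
        finally show ?thesis using N by simp
      qed
      then show "\<exists>N. \<forall>k\<ge>N. dist (y k) x < c" by blast
    qed
    then have "(\<lambda>k. y (r k)) \<longlonglongrightarrow> x"
      using LIMSEQ_subseq_LIMSEQ[OF _ r] by (auto simp: o_def)
    then have "(\<lambda>k. h (y (r k))) \<longlonglongrightarrow> h x"
      by (rule continuous_on_tendsto_compose[OF cont]) (use R yR in auto)
    then have "\<forall>\<^sub>F k in sequentially. dist (h (y (r k))) (h x) < e / 3"
      by (rule tendstoD) (use e in simp)
    moreover have "\<forall>\<^sub>F k in sequentially. \<forall>z\<in>cball x R. dist (?f (m (r k)) z) (h z) < e / 3"
      by (rule uniform_limitD[OF unif]) (use e in simp)
    ultimately have "\<forall>\<^sub>F k :: nat in sequentially. False"
    proof eventually_elim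
      case (elim k)
      have "dist (?f (m (r k)) (y (r k))) (h (y (r k))) < e / 3" using elim(2) yR by blast
      moreover have "dist (?f (m (r k)) x) (h x) < e / 3" using elim(2) R(1) by simp
      ultimately have "dist (?f (m (r k)) (y (r k))) (?f (m (r k)) x) < e"
        using elim(1) by (metis dist_commute dist_triangle_third)
      then show False using far[of "r k"] by simp
    qed
    then show False by simp
  qed
  then obtain d where d: "d > 0" "\<forall>n. \<forall>y\<in>ball x d. dist (?f n y) (?f n x) < e" by blast
  show thesis
    by (rule that[of "min d R"]) (use d R in auto)
qed

text \<open>Vitali's theorem in one variable suffices, since a point \<open>x\<close> of \<open>B\<close> is joined to a point \<open>a\<close> of \<open>A\<close>
  by a complex line. The parameter values for which the line is in \<open>B\<close> form a convex open set, and
  on it the coordinates \<open>1/z\<close> and \<open>w/z\<close> of the late iterates are holomorphic and bounded by 1.\<close>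

lemma horizontal_limit_spreads:
  assumes F: "entire_map F" and B: "open B" "convex B"
    and chart: "\<And>n x. n \<ge> N \<Longrightarrow> x \<in> B \<Longrightarrow>
      norm (snd ((F ^^ n) x)) < norm (fst ((F ^^ n) x)) \<and> 1 < norm (fst ((F ^^ n) x))"
    and A: "open A" "A \<subseteq> B" "a \<in> A"
    and lim: "\<And>x. x \<in> A \<Longrightarrow> (\<lambda>n. affine_embed ((F ^^ n) x)) \<longlonglongrightarrow> hom_pt 1 0 0"
    and x: "x \<in> B"
  shows "(\<lambda>n. affine_embed ((F ^^ n) x)) \<longlonglongrightarrow> hom_pt 1 0 0"
proof -
  define L where "L = (\<lambda>t. (fst a + t * fst (x - a), snd a + t * snd (x - a)))"
  define Z W where "Z = (\<lambda>n t. fst ((F ^^ (n + N)) (L t)))" and "W = (\<lambda>n t. snd ((F ^^ (n + N)) (L t)))"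
  have contL: "continuous_on UNIV L" unfolding L_def by (intro continuous_intros)
  have L01: "L 0 = a" "L 1 = x" by (simp_all add: L_def)
  have hol: "Z n holomorphic_on X" "W n holomorphic_on X" for n X
    using entire_map_funpow[OF F, of "n + N"] unfolding entire_map_def Z_def W_def L_def
    by (auto intro: entire2_holomorphic_on_line)
  have openS: "open (L -` B)" and openT: "open (L -` A)"
    using contL B A by (auto intro: open_vimage)
  have "convex (L -` B)"
  proof (rule convexI)
    fix s t and u v :: real assume *: "s \<in> L -` B" "t \<in> L -` B" "0 \<le> u" "0 \<le> v" "u + v = 1"
    have uv: "complex_of_real u + complex_of_real v = 1"
      using *(5) by (metis of_real_1 of_real_add)
    have split: "c = of_real u * c + of_real v * c" for c :: complex
      using uv by (simp flip: distrib_right)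
    have "L (u *\<^sub>R s + v *\<^sub>R t) = u *\<^sub>R L s + v *\<^sub>R L t"
      unfolding L_def
      by (subst (1) split[of "fst a"], subst (1) split[of "snd a"])
         (simp add: scaleR_conv_of_real algebra_simps)
    then show "u *\<^sub>R s + v *\<^sub>R t \<in> L -` B"
      using * B(2) by (auto simp: convex_def)
  qed
  then have conn: "connected (L -` B)" by (rule convex_connected)
  have big: "norm (W n t) < norm (Z n t)" "1 < norm (Z n t)" if "t \<in> L -` B" for n t
    using chart[of "n + N" "L t"] that by (auto simp: Z_def W_def)
  then have Z0: "Z n t \<noteq> 0" if "t \<in> L -` B" for n t using big(2)[OF that, of n] by auto
  have limT: "(\<lambda>n. 1 / Z n t) \<longlonglongrightarrow> 0" "(\<lambda>n. W n t / Z n t) \<longlonglongrightarrow> 0" if "t \<in> L -` A" for t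
  proof -
    have "(\<lambda>n. affine_embed ((F ^^ (n + N)) (L t))) \<longlonglongrightarrow> hom_pt 1 0 0"
      using lim[of "L t"] that by (intro LIMSEQ_ignore_initial_segment) auto
    then have "(\<lambda>n. affine_embed (Z n t, W n t)) \<longlonglongrightarrow> hom_pt 1 0 0" by (simp add: Z_def W_def)
    then show "(\<lambda>n. 1 / Z n t) \<longlonglongrightarrow> 0" "(\<lambda>n. W n t / Z n t) \<longlonglongrightarrow> 0"
      by (rule affine_embed_tendsto_horizontalD)+
  qed
  have one: "1 \<in> L -` B" using x L01 by simp
  have T: "L -` A \<noteq> {}" "L -` A \<subseteq> L -` B" using A L01 by auto
  have "(\<lambda>n. 1 / Z n 1) \<longlonglongrightarrow> 0"
    by (rule Vitali_zero[OF openS conn _ _ openT T limT(1) one, where B = 1])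
       (use big Z0 hol in \<open>auto intro!: holomorphic_intros simp: norm_divide less_imp_le divide_le_eq_1\<close>)
  moreover have "(\<lambda>n. W n 1 / Z n 1) \<longlonglongrightarrow> 0"
    by (rule Vitali_zero[OF openS conn _ _ openT T limT(2) one, where B = 1])
       (use big Z0 hol in \<open>auto intro!: holomorphic_intros simp: norm_divide less_imp_le divide_le_eq_1\<close>)
  ultimately have "(\<lambda>n. affine_embed (Z n 1, W n 1)) \<longlonglongrightarrow> hom_pt 1 0 0"
    using Z0[OF one] by (intro affine_embed_tendsto_horizontalI) auto
  then have "(\<lambda>n. affine_embed ((F ^^ (n + N)) x)) \<longlonglongrightarrow> hom_pt 1 0 0"
    by (simp add: Z_def W_def L01)
  then show ?thesis by (rule LIMSEQ_offset)
qed

text \<open>The set \<open>A\<close> in the proof is open by definition. The work is to show that it is closed relative to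
  \<open>U\<close>; connectedness of \<open>U\<close> does the rest.\<close>

lemma fatou_component_horizontal_limit:
  assumes F: "entire_map F" and U: "fatou_component F U"
    and V: "open V" "V \<subseteq> U" "V \<noteq> {}"
    and lim: "\<And>x. x \<in> V \<Longrightarrow> (\<lambda>n. affine_embed ((F ^^ n) x)) \<longlonglongrightarrow> hom_pt 1 0 0"
    and x: "x \<in> U"
  shows "(\<lambda>n. affine_embed ((F ^^ n) x)) \<longlonglongrightarrow> hom_pt 1 0 0"
proof -
  let ?f = "\<lambda>n y. affine_embed ((F ^^ n) y)" and ?P = "hom_pt 1 0 0"
  define A where "A = interior {y. (\<lambda>n. ?f n y) \<longlonglongrightarrow> ?P}"
  have Alim: "(\<lambda>n. ?f n y) \<longlonglongrightarrow> ?P" if "y \<in> A" for y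
    using that interior_subset by (auto simp: A_def)
  have "V \<subseteq> A" unfolding A_def using V(1) lim by (intro interior_maximal) auto
  have clA: "y \<in> A" if y: "y \<in> U" "y \<in> closure A" for y
  proof -
    have "y \<in> fatou_set F" using U y(1) in_components_subset by (auto simp: fatou_component_def)
    then obtain N where N: "open N" "iterates_normal_on F N" "y \<in> N"
      by (auto simp: fatou_set_def)
    obtain e where e: "e > 0" and chart: "\<And>z w. dist (affine_embed (z, w)) ?P < e \<Longrightarrow>
        norm w < norm z \<and> 1 < norm z"
      using eventually_nhds_horizontal[of 1] by (auto simp: eventually_nhds_metric)
    obtain d where d: "d > 0"
      and eq: "\<And>n u. u \<in> ball y d \<Longrightarrow> dist (?f n u) (?f n y) < e / 3"
      by (rule normal_imp_equicontinuous[OF F N(2,1,3), of "e / 3"]) (use e in auto)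
    obtain a where a: "a \<in> A" "dist a y < d" using y(2) d by (auto simp: closure_approachable)
    have "\<forall>\<^sub>F n in sequentially. dist (?f n a) ?P < e / 3"
      using tendstoD[OF Alim[OF a(1)], of "e / 3"] e by simp
    then obtain M where M: "\<And>n. n \<ge> M \<Longrightarrow> dist (?f n a) ?P < e / 3"
      by (auto simp: eventually_sequentially)
    \<comment> \<open>Equicontinuity is uniform in \<open>n\<close>, so closeness to \<open>?P\<close> passes from the one orbit of \<open>a\<close> to
      all orbits that start in a fixed ball around \<open>y\<close>.\<close>
    have near: "dist (?f n u) ?P < e" if "n \<ge> M" "u \<in> ball y d" for n u
    proof -
      have "dist (?f n a) (?f n y) < e / 3" using eq[of a n] a by (simp add: dist_commute)
      with eq[OF that(2)] M[OF that(1)] show ?thesis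
        by (metis dist_commute dist_triangle_third)
    qed
    have "(\<lambda>n. ?f n u) \<longlonglongrightarrow> ?P" if "u \<in> ball y d" for u
    proof (rule horizontal_limit_spreads[OF F _ _ _ _ _ _ _ that, where N = M])
      show "norm (snd ((F ^^ n) v)) < norm (fst ((F ^^ n) v)) \<and> 1 < norm (fst ((F ^^ n) v))"
        if "n \<ge> M" "v \<in> ball y d" for n v
        using chart[of "fst ((F ^^ n) v)" "snd ((F ^^ n) v)"] near[OF that] by simp
      show "open (A \<inter> ball y d)" by (simp add: A_def open_Int)
      show "a \<in> A \<inter> ball y d" using a by (simp add: dist_commute)
    qed (use Alim in auto)
    then have "ball y d \<subseteq> A" unfolding A_def by (intro interior_maximal) auto
    then show ?thesis using d by auto
  qed
  have "A \<inter> U = {} \<or> - closure A \<inter> U = {}"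
  proof (rule connectedD)
    show "connected U" using U in_components_connected by (auto simp: fatou_component_def)
    show "A \<inter> - closure A \<inter> U = {}" using closure_subset[of A] by auto
  qed (use clA in \<open>auto simp: A_def\<close>)
  then have "U \<subseteq> closure A" using \<open>V \<subseteq> A\<close> V by auto
  then show ?thesis using clA x Alim by blast
qed

section \<open>Normality from uniform convergence\<close>

lemma nat_seq_cases:
  fixes m :: "nat \<Rightarrow> nat"
  obtains (const) r c where "strict_mono (r :: nat \<Rightarrow> nat)" "\<And>k. m (r k) = c"
    | (infinite) "filterlim m at_top sequentially"
proof (cases "\<exists>c. infinite {k. m k = c}")
  case True
  then show ?thesis using const infinite_enumerate by (metis (mono_tags, lifting) mem_Collect_eq)
next
  case False
  have "\<forall>\<^sub>F k in sequentially. m k \<ge> C" for C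
  proof -
    have "{k. \<not> m k \<ge> C} = (\<Union>c<C. {k. m k = c})" by auto
    then have "finite {k. \<not> m k \<ge> C}" using False by simp
    then show ?thesis by (simp add: eventually_cofinite flip: cofinite_eq_sequentially)
  qed
  then show ?thesis by (intro infinite) (simp add: filterlim_at_top)
qed

text \<open>Normality concerns arbitrary sequences of iterates. One that repeats an iterate infinitely often
  has a constant subsequence; in any other the exponents tend to infinity.\<close>

lemma uniform_limit_imp_iterates_normal:
  assumes "uniform_limit U (\<lambda>n x. affine_embed ((F ^^ n) x)) h sequentially"
  shows "iterates_normal_on F U"
  unfolding iterates_normal_on_def
proof
  fix m :: "nat \<Rightarrow> nat"
  show "\<exists>r h. strict_mono r \<and> (\<forall>K. compact K \<longrightarrow> K \<subseteq> U \<longrightarrow>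
      uniform_limit K (\<lambda>k x. affine_embed ((F ^^ m (r k)) x)) h sequentially)"
  proof (cases rule: nat_seq_cases[of m])
    case (const r c)
    then show ?thesis
      by (intro exI[of _ r] exI[of _ "\<lambda>x. affine_embed ((F ^^ c) x)"]) (simp add: uniform_limit_const)
  next
    case infinite
    have "uniform_limit U (\<lambda>k x. affine_embed ((F ^^ m k) x)) h sequentially"
      using filterlim_compose[OF assms infinite] by simp
    then show ?thesis
      by (intro exI[of _ id] exI[of _ h]) (auto simp: strict_mono_def intro: uniform_limit_on_subset)
  qed
qed

text \<open>Uniform convergence on \<open>U\<close> is convergence along the product of the index filter with the principal
  filter of \<open>U\<close>. This makes limit rules for single sequences applicable to uniform limits.\<close>

lemma eventually_prod_principal:
  "eventually P (G \<times>\<^sub>F principal U) \<longleftrightarrow> (\<forall>\<^sub>F n in G. \<forall>x\<in>U. P (n, x))"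
proof
  assume "eventually P (G \<times>\<^sub>F principal U)"
  then obtain Q R where "eventually Q G" "\<forall>x\<in>U. R x" "\<And>n x. Q n \<Longrightarrow> R x \<Longrightarrow> P (n, x)"
    by (auto simp: eventually_prod_filter eventually_principal)
  then show "\<forall>\<^sub>F n in G. \<forall>x\<in>U. P (n, x)" by (auto elim: eventually_mono)
next
  assume "\<forall>\<^sub>F n in G. \<forall>x\<in>U. P (n, x)"
  then show "eventually P (G \<times>\<^sub>F principal U)"
    unfolding eventually_prod_filter eventually_principal
    by (intro exI[of _ "\<lambda>n. \<forall>x\<in>U. P (n, x)"] exI[of _ "\<lambda>x. x \<in> U"]) auto
qed

lemma uniform_limit_horizontal:
  assumes "filterlim b at_top G"
    and "\<forall>\<^sub>F n in G. \<forall>x\<in>U. norm (fst (f n x)) \<ge> b n \<and> norm (snd (f n x)) \<le> C"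
  shows "uniform_limit U (\<lambda>n x. affine_embed (f n x)) (\<lambda>_. hom_pt 1 0 0) G"
proof -
  let ?G = "G \<times>\<^sub>F principal U"
  have ev: "\<forall>\<^sub>F p in ?G. norm (fst (f (fst p) (snd p))) \<ge> b (fst p) \<and> norm (snd (f (fst p) (snd p))) \<le> C"
    using assms(2) by (auto simp: eventually_prod_principal case_prod_beta)
  have z: "filterlim (\<lambda>p. norm (fst (f (fst p) (snd p)))) at_top ?G"
  proof (rule filterlim_at_top_mono)
    show "filterlim (\<lambda>p. b (fst p)) at_top ?G"
      using filterlim_compose[OF assms(1) filterlim_fst] .
  qed (use ev in \<open>auto elim: eventually_mono\<close>)
  then have inf: "filterlim (\<lambda>p. fst (f (fst p) (snd p))) at_infinity ?G"
    by (rule filterlim_norm_at_top_imp_at_infinity)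
  have "((\<lambda>p. affine_embed (fst (f (fst p) (snd p)), snd (f (fst p) (snd p)))) \<longlongrightarrow> hom_pt 1 0 0) ?G"
  proof (rule affine_embed_tendsto_horizontalI)
    show *: "((\<lambda>p. 1 / fst (f (fst p) (snd p))) \<longlongrightarrow> 0) ?G"
      by (rule tendsto_divide_0[OF tendsto_const inf])
    show "((\<lambda>p. snd (f (fst p) (snd p)) / fst (f (fst p) (snd p))) \<longlongrightarrow> 0) ?G"
    proof (rule Lim_null_comparison)
      show "\<forall>\<^sub>F p in ?G. norm (snd (f (fst p) (snd p)) / fst (f (fst p) (snd p)))
          \<le> C * norm (1 / fst (f (fst p) (snd p)))"
        using ev by eventually_elim (simp add: norm_divide divide_right_mono)
      show "((\<lambda>p. C * norm (1 / fst (f (fst p) (snd p)))) \<longlongrightarrow> 0) ?G"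
        using tendsto_mult_right_zero[OF tendsto_norm_zero[OF *]] .
    qed
    show "\<forall>\<^sub>F p in ?G. fst (f (fst p) (snd p)) \<noteq> 0"
      using filterlim_at_top_dense[THEN iffD1, OF z, rule_format, of 0] by (auto elim: eventually_mono)
  qed
  then show ?thesis
    by (simp add: uniform_limit_iff tendsto_iff eventually_prod_principal)
qed

section \<open>Transcendence of exponentials\<close>

text \<open>The polynomial takes its value at 0 at all multiples of the period.\<close>

lemma periodic_poly_constant:
  fixes p :: "complex poly"
  assumes "c \<noteq> 0" "\<And>z. poly p (z + c) = poly p z"
  shows "poly p z = poly p 0"
proof -
  have *: "poly p (of_nat k * c) = poly p 0" for k :: nat
  proof (induction k)
    case (Suc k)
    then show ?case using assms(2)[of "of_nat k * c"] by (simp add: algebra_simps)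
  qed simp
  have "infinite (range (\<lambda>k :: nat. of_nat k * c))"
    using assms(1) by (intro range_inj_infinite) (auto simp: inj_def)
  moreover have "range (\<lambda>k :: nat. of_nat k * c) \<subseteq> {z. poly (p - [:poly p 0:]) z = 0}"
    using * by auto
  ultimately have "p - [:poly p 0:] = 0"
    using poly_roots_finite finite_subset by blast
  then have "p = [:poly p 0:]" by simp
  then show ?thesis by (metis poly_pCons poly_0 mult_zero_right add_0_right)
qed

lemma exp_affine_not_poly:
  fixes p :: "complex poly"
  assumes "a \<noteq> 0"
  shows "\<exists>z. exp (a * z + b) \<noteq> poly p z"
proof (rule ccontr)
  assume "\<not> ?thesis"
  then have p: "poly p z = exp (a * z + b)" for z by simp
  have "poly p (1 / a) = poly p 0"
    by (rule periodic_poly_constant[of "2 * of_real pi * \<i> / a"])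
       (use assms in \<open>simp_all add: p algebra_simps exp_add\<close>)
  then have "exp (1 :: complex) = 1" using assms by (simp add: p exp_add)
  then show False by (simp add: exp_eq_1)
qed

lemma polynomial2_restrict:
  assumes "polynomial2 f"
  obtains p where "\<And>z. f (z, w) = poly p z"
proof -
  obtain N :: nat and c where c: "\<And>z w. f (z, w) = (\<Sum>i\<le>N. \<Sum>j\<le>N. c i j * z ^ i * w ^ j)"
    using assms unfolding polynomial2_def by blast
  show thesis
    by (rule that[of "\<Sum>i\<le>N. monom (\<Sum>j\<le>N. c i j * w ^ j) i"])
       (simp add: c poly_sum poly_monom sum_distrib_right sum_distrib_left mult_ac)
qed

section \<open>A skew-product with a Baker domain\<close>

definition fatou_skew :: "complex \<times> complex \<Rightarrow> complex \<times> complex" where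
  "fatou_skew = (\<lambda>(z, w). (z + 2 + exp (- z), exp (w - 1)))"

lemma transcendental_fatou_skew: "transcendental_skew_product fatou_skew"
  unfolding transcendental_skew_product_def
proof (intro exI conjI)
  let ?f = "\<lambda>(z, w :: complex). z + 2 + exp (- z :: complex)"
  have "entire2 (\<lambda>x. fst x + 2 + exp (- fst x))"
    by (rule entire2_holomorphic_comp[of "\<lambda>z. z + 2 + exp (- z)"])
       (auto intro!: holomorphic_intros entire2_fst)
  moreover have "\<not> polynomial2 ?f"
  proof
    assume "polynomial2 ?f"
    then obtain p where p: "\<And>z :: complex. z + 2 + exp (- z) = poly p z"
      using polynomial2_restrict[of ?f 0] by auto
    then have "exp (- z) = poly (p - [:2, 1:]) z" for z
      by (simp flip: p)
    then show False using exp_affine_not_poly[of "-1" 0 "p - [:2, 1:]"] by auto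
  qed
  ultimately show "transcendental_entire2 ?f"
    unfolding transcendental_entire2_def case_prod_beta by blast
  have "\<nexists>p. (\<lambda>w :: complex. exp (w - 1)) = poly p"
    using exp_affine_not_poly[of 1 "-1"] by (auto simp: fun_eq_iff)
  then show "transcendental_entire (\<lambda>w. exp (w - 1))"
    unfolding transcendental_entire_def by (auto intro!: holomorphic_intros)
  show "fatou_skew = (\<lambda>(z, w). (?f (z, w), exp (w - 1)))"
    by (simp add: fatou_skew_def)
qed

lemma entire_map_fatou_skew: "entire_map fatou_skew"
  unfolding entire_map_def fatou_skew_def case_prod_beta fst_conv snd_conv
  by (intro conjI entire2_holomorphic_comp[of "\<lambda>z. z + 2 + exp (- z)"]
        entire2_holomorphic_comp[of "\<lambda>w. exp (w - 1)"])
     (auto intro!: holomorphic_intros entire2_fst entire2_snd)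

lemma fatou_skew_iterate:
  assumes "0 < Re (fst x)" "norm (snd x) < 1"
  shows "real n < Re (fst ((fatou_skew ^^ n) x)) \<and> norm (snd ((fatou_skew ^^ n) x)) < 1"
proof (induction n)
  case 0
  then show ?case using assms by simp
next
  case (Suc n)
  obtain z w where zw: "(fatou_skew ^^ n) x = (z, w)" by fastforce
  have z: "real n < Re z" and w: "norm w < 1" using Suc by (auto simp: zw)
  have "norm (exp (- z)) < 1" using z by simp
  then have "Re (exp (- z)) > - 1" using abs_Re_le_cmod[of "exp (- z)"] by linarith
  moreover have "Re w < 1" using complex_Re_le_cmod[of w] w by linarith
  ultimately show ?case using z by (simp add: zw) (simp add: fatou_skew_def)
qed

abbreviation invariant_domain :: "(complex \<times> complex) set" where
  "invariant_domain \<equiv> {x. 0 < Re (fst x) \<and> norm (snd x) < 1}"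

lemma fatou_skew_uniform_limit:
  "uniform_limit invariant_domain (\<lambda>n x. affine_embed ((fatou_skew ^^ n) x))
     (\<lambda>_. hom_pt 1 0 0) sequentially"
proof (rule uniform_limit_horizontal[OF filterlim_real_sequentially])
  have "norm (fst ((fatou_skew ^^ n) x)) \<ge> real n \<and> norm (snd ((fatou_skew ^^ n) x)) \<le> 1"
    if "x \<in> invariant_domain" for n x
    using fatou_skew_iterate[of x n] that complex_Re_le_cmod[of "fst ((fatou_skew ^^ n) x)"] by auto
  then show "\<forall>\<^sub>F n in sequentially. \<forall>x\<in>invariant_domain.
      norm (fst ((fatou_skew ^^ n) x)) \<ge> real n \<and> norm (snd ((fatou_skew ^^ n) x)) \<le> 1" by simp
qed

text \<open>For \<open>c \<noteq> 0\<close> one takes \<open>u n = Ln c + n\<close>. The value \<open>c = 0\<close> has no logarithm, which is why only the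
  limit of \<open>exp (u n - n)\<close> is prescribed; then \<open>u = 0\<close> serves.\<close>

lemma ex_exp_asymptotics:
  fixes c :: complex
  obtains u :: "nat \<Rightarrow> complex"
  where "(\<lambda>n. of_real (exp (- real n)) * exp (u n)) \<longlonglongrightarrow> c"
    and "(\<lambda>n. of_real (1 / real n ^ 2) * u n) \<longlonglongrightarrow> 0"
proof (cases "c = 0")
  case True
  have "(\<lambda>n. exp (- real n)) \<longlonglongrightarrow> 0" by real_asymp
  from tendsto_of_real[OF this, where 'a = complex] show ?thesis
    by (intro that[of "\<lambda>_. 0"]) (use True in simp_all)
next
  case False
  have "(\<lambda>n. complex_of_real (1 / real n ^ 2)) \<longlonglongrightarrow> of_real 0"
    by (intro tendsto_of_real) real_asymp
  moreover have "(\<lambda>n. complex_of_real (1 / real n ^ 2 * real n)) \<longlonglongrightarrow> of_real 0"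
    by (intro tendsto_of_real) real_asymp
  ultimately have
    "(\<lambda>n. of_real (1 / real n ^ 2) * Ln c + of_real (1 / real n ^ 2 * real n)) \<longlonglongrightarrow> of_real 0 * Ln c + of_real 0"
    by (intro tendsto_add tendsto_mult tendsto_const)
  moreover have "of_real (exp (- real n)) * exp (Ln c + of_real (real n)) = c" for n
    using False by (simp add: exp_add exp_minus flip: exp_of_real)
  ultimately show ?thesis
    by (intro that[of "\<lambda>n. Ln c + of_real (real n)"]) (simp_all add: distrib_left)
qed

lemma essential_singularity_fatou_skew:
  "essential_singularity_at_infinity fatou_skew (hom_pt 1 0 0)"
  unfolding essential_singularity_at_infinity_def
proof (intro conjI ballI)
  show "hom_pt 1 0 0 \<in> line_at_infinity" unfolding line_at_infinity_def by force
next
  fix Q assume "Q \<in> line_at_infinity"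
  then obtain s t where Q: "Q = hom_pt s t 0" "(s, t) \<noteq> (0, 0)" unfolding line_at_infinity_def by auto
  show "\<exists>x. (\<lambda>n. affine_embed (x n)) \<longlonglongrightarrow> hom_pt 1 0 0 \<and>
      (\<lambda>n. affine_embed (fatou_skew (x n))) \<longlonglongrightarrow> Q"
  proof (cases "t = 0")
    case True
    then have Q1: "Q = hom_pt 1 0 0" using hom_pt_scale[of s 1 0 0] Q by simp
    \<comment> \<open>The orbit of \<open>(1, 0)\<close> is such a sequence: \<open>F\<close> only shifts it by one step.\<close>
    have "(\<lambda>n. affine_embed ((fatou_skew ^^ n) (1, 0))) \<longlonglongrightarrow> hom_pt 1 0 0"
      by (rule tendsto_uniform_limitI[OF fatou_skew_uniform_limit]) simp
    with LIMSEQ_Suc[OF this] show ?thesis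
      unfolding Q1 by (intro exI[of _ "\<lambda>n. (fatou_skew ^^ n) (1, 0)"]) simp
  next
    case False
    define c where "c = s / t"
    have Qc: "Q = hom_pt c 1 0" using hom_pt_scale[of t c 1 0] False Q by (simp add: c_def)
    obtain u where exp_u: "(\<lambda>n. of_real (exp (- real n)) * exp (u n)) \<longlonglongrightarrow> c"
      and u: "(\<lambda>n. of_real (1 / real n ^ 2) * u n) \<longlonglongrightarrow> 0"
      by (rule ex_exp_asymptotics)
    define z where "z n = 2 * of_real pi * \<i> * of_nat (n ^ 2) - u n" for n
    define w :: "nat \<Rightarrow> complex" where "w n = of_real (real n + 1)" for n
    \<comment> \<open>The scaling by \<open>k\<close> exhibits the limit of the points, and the scaling by \<open>l\<close> that of their images.\<close>
    define k where "k n = complex_of_real (1 / real n ^ 2)" for n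
    define l where "l n = complex_of_real (exp (- real n))" for n
    have k0: "k \<longlonglongrightarrow> of_real 0" unfolding k_def by (intro tendsto_of_real) real_asymp
    have kn0: "\<forall>\<^sub>F n in sequentially. k n \<noteq> 0"
      using eventually_gt_at_top[of 0] by eventually_elim (simp add: k_def)
    have "\<forall>\<^sub>F n in sequentially. 2 * of_real pi * \<i> - k n * u n = k n * z n"
      using eventually_gt_at_top[of 0] by eventually_elim (simp add: k_def z_def field_simps)
    moreover have "(\<lambda>n. 2 * of_real pi * \<i> - k n * u n) \<longlonglongrightarrow> 2 * of_real pi * \<i> - 0"
      using u unfolding k_def by (intro tendsto_intros)
    ultimately have kz: "(\<lambda>n. k n * z n) \<longlonglongrightarrow> 2 * of_real pi * \<i>"
      using Lim_transform_eventually by fastforce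
    have "(\<lambda>n. complex_of_real (1 / real n ^ 2 * (real n + 1))) \<longlonglongrightarrow> of_real 0"
      by (intro tendsto_of_real) real_asymp
    then have kw: "(\<lambda>n. k n * w n) \<longlonglongrightarrow> 0" by (simp add: k_def w_def)
    have "(\<lambda>n. affine_embed (z n, w n)) \<longlonglongrightarrow> hom_pt (2 * of_real pi * \<i>) 0 0"
      using kz kw k0 kn0 by (intro affine_embed_tendsto_infinity[of k]) auto
    then have xP: "(\<lambda>n. affine_embed (z n, w n)) \<longlonglongrightarrow> hom_pt 1 0 0"
      using hom_pt_scale[of "2 * of_real pi * \<i>" 1 0 0] by simp
    have ln0: "l n \<noteq> 0" for n by (simp add: l_def)
    have l0: "l \<longlonglongrightarrow> of_real 0" unfolding l_def by (intro tendsto_of_real) real_asymp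
    have "(\<lambda>n. complex_of_real (exp (- real n) * real n ^ 2)) \<longlonglongrightarrow> of_real 0"
      by (intro tendsto_of_real) real_asymp
    then have "(\<lambda>n. of_real (exp (- real n) * real n ^ 2) * (k n * z n)) \<longlonglongrightarrow>
        of_real 0 * (2 * of_real pi * \<i>)"
      using kz by (rule tendsto_mult)
    moreover have "\<forall>\<^sub>F n in sequentially.
        of_real (exp (- real n) * real n ^ 2) * (k n * z n) = l n * z n"
      using eventually_gt_at_top[of 0] by eventually_elim (simp add: k_def l_def)
    ultimately have lz: "(\<lambda>n. l n * z n) \<longlonglongrightarrow> 0"
      using Lim_transform_eventually by fastforce
    have "exp (2 * of_real pi * \<i> * of_nat (n ^ 2)) = 1" for n
      using exp_integer_2pi[of "of_nat (n ^ 2)"] by (simp add: mult_ac)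
    then have ez: "exp (- z n) = exp (u n)" for n by (simp add: z_def exp_diff)
    have "(\<lambda>n. l n * z n + l n * 2 + l n * exp (u n)) \<longlonglongrightarrow> 0 + of_real 0 * 2 + c"
      using lz l0 exp_u unfolding l_def[symmetric]
      by (intro tendsto_add tendsto_mult_right)
    then have lf: "(\<lambda>n. l n * (z n + 2 + exp (- z n))) \<longlonglongrightarrow> c"
      by (simp add: ez algebra_simps)
    have lg: "(\<lambda>n. l n * exp (w n - 1)) \<longlonglongrightarrow> 1"
      by (simp add: l_def w_def exp_minus flip: exp_of_real)
    have "(\<lambda>n. affine_embed (z n + 2 + exp (- z n), exp (w n - 1))) \<longlonglongrightarrow> hom_pt c 1 0"
      using l0 by (intro affine_embed_tendsto_infinity[OF lf lg]) (simp_all add: ln0)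
    then have "(\<lambda>n. affine_embed (fatou_skew (z n, w n))) \<longlonglongrightarrow> Q"
      by (simp add: fatou_skew_def Qc)
    with xP show ?thesis by (intro exI[of _ "\<lambda>n. (z n, w n)"] conjI)
  qed
qed

theorem theorem1:
  shows "\<exists>F. transcendental_skew_product F \<and> (\<exists>U. baker_domain F U)"
proof -
  have openV: "open invariant_domain"
    by (intro open_Collect_conj open_Collect_less continuous_intros)
  then have VF: "invariant_domain \<subseteq> fatou_set fatou_skew"
    using uniform_limit_imp_iterates_normal[OF fatou_skew_uniform_limit] by (auto simp: fatou_set_def)
  have "invariant_domain = {z. 0 < Re z} \<times> ball 0 1" by auto
  then have connV: "connected invariant_domain"
    by (metis connected_Times convex_halfspace_Re_gt convex_connected connected_ball)
  have inV: "(1, 0) \<in> invariant_domain" by simp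
  define U where "U = connected_component_set (fatou_set fatou_skew) (1, 0)"
  have comp: "fatou_component fatou_skew U"
    using VF inV unfolding fatou_component_def U_def components_def by blast
  have VU: "invariant_domain \<subseteq> U"
    unfolding U_def using connected_component_maximal[OF inV connV VF] .
  have "(\<lambda>n. affine_embed ((fatou_skew ^^ n) x)) \<longlonglongrightarrow> hom_pt 1 0 0" if "x \<in> U" for x
    by (rule fatou_component_horizontal_limit[OF entire_map_fatou_skew comp openV VU _ _ that])
       (use inV tendsto_uniform_limitI[OF fatou_skew_uniform_limit] in blast)+
  then have "baker_domain fatou_skew U"
    unfolding baker_domain_def using comp essential_singularity_fatou_skew by blast
  then show ?thesis using transcendental_fatou_skew by blast
qed

end
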